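(* Let $G=(V,E,l)$ be a finite connected undirected simple metric graph, let $v^*\in V$, and fix ordered graph data $(G,l,\{\sigma_v\}_{v\in V},\pi_0)$ with associated auxiliary interval exchange transformation $T_{\mathrm{aux}}$. Suppose that $T_{\mathrm{aux}}$ satisfies the $\varepsilon$-birth-time transfer estimate with a function $H_T(\varepsilon)$, and that, for some $\kappa>0$ and $C>0$, $H_T(\varepsilon)\le C\varepsilon^{-\kappa}$ for all sufficiently small $\varepsilon>0$. Suppose moreover that the transfer function satisfies $$H_T(\varepsilon)\le C_\eta\,\varepsilon^{-\frac{1+\eta}{1-\eta}}$$ for every $\eta>0$ and all sufficiently small $\varepsilon>0$, where $C_\eta$ is a constant depending on $\eta$. Then $$\tau_s(\varepsilon)\le K_\eta\,\varepsilon^{-\frac{1+\eta}{1-\eta}}$$ for all sufficiently small $\varepsilon>0$, where $K_\eta$ is a constant depending on $\eta$ and $\tau_s(\varepsilon)$ is the moment of permanent $\varepsilon$-saturation of $\mathcal W(G,v^* )$.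
   Context: A metric graph $G=(V,E,l)$ is a graph $(V,E)$ with a length function $l:E\to\mathbb R_{>0}$; each edge $e$ is identified with an interval of length $l(e)$. Graphs are undirected and simple (no loops, at most one edge between two vertices). $\overrightarrow E$ is the set of oriented edges. For $a=(u\to w)\in\overrightarrow E$ put $\bar a=(w\to u)$, $t(a)=u$, $h(a)=w$, $l(a)=l(\{u,w\})$. A walk from $v^*$ to $v$ is a finite sequence of vertices $(v_0,\dots,v_n)$ with $v_0=v^*$, $v_n=v$, $\{v_{i-1},v_i\}\in E$; its metric length is $\sum_i l(\{v_{i-1},v_i\})$ (the empty walk at $v^*$ has length $0$). $\mathcal A_v$ is the set of metric lengths of all finite walks from $v^*$ to $v$; its elements are the birth times at $v$. The dynamics $\mathcal W(G,v^* )$ (time $t\in\mathbb R_{\ge 0}$, space the metric graph): each moving point lies on an oriented edge and moves at unit speed toward its head. When a moving point reaches a vertex $v$, it is removed and new moving points are created at $v$, one on each oriented edge issuing from $v$ (including the reverse of the edge of arrival), each moving away from $v$ at unit speed. At time $0$ moving points are created at $v^*$ on all oriented edges issuing from $v^*$. The system is $\varepsilon$-saturated at time $t$ if the moving points at time $t$ form an $\varepsilon$-net of the metric graph (every point is within distance at most $\varepsilon$ of some moving point). $\tau_s(\varepsilon)=\inf\{t_0\ge0:\mathcal W(G,v^* )\text{ is }\varepsilon\text{-saturated at every }t\ge t_0\}$ (with $\inf\emptyset=+\infty$). Ordered graph data: for each $v\in V$, $\sigma_v$ is a cyclic permutation (a single cycle) of $\{a\in\overrightarrow E:t(a)=v\}$,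 and $\pi_0:\overrightarrow E\to\{1,\dots,d\}$, $d=|\overrightarrow E|$, is a bijection. Put $\Phi(a)=\sigma_{h(a)}(\bar a)$ (a permutation of $\overrightarrow E$), define $\pi_1$ by $\pi_1(\Phi(a))=\pi_0(a)$, let $\lambda_a=l(a)$ and $L=\sum_a\lambda_a$. The auxiliary interval exchange transformation $T_{\mathrm{aux}}:[0,L)\to[0,L)$ translates, for each $a$, the interval $I_a=[\sum_{\pi_0(b)<\pi_0(a)}\lambda_b,\sum_{\pi_0(b)\le\pi_0(a)}\lambda_b)$ onto $J_a=[\sum_{\pi_1(b)<\pi_1(a)}\lambda_b,\sum_{\pi_1(b)\le\pi_1(a)}\lambda_b)$. Transfer estimate: $T_{\mathrm{aux}}$ satisfies an $\varepsilon$-birth-time transfer estimate with function $H_T(\varepsilon)$ if, for every sufficiently small $\varepsilon>0$, every oriented edge $a=(u\to w)$, every $t\ge H_T(\varepsilon)+l(a)$, and every $s\in[0,l(a)-\varepsilon]$, there exists a birth time $\tau\in\mathcal A_u$ such that $0\le t-s-\tau\le\varepsilon$.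
   Formalization: Here η ranges over 0 < η < 1 in both hypothesis and conclusion, instead of every η > 0: at η = 1 the exponent is undefined, and for η > 1 the assumed bound forces H_T(ε) to at most 0 in the limit, which is impossible since birth times are locally finite. *)

theory Defs
  imports
    Complex_Main
    "HOL-Library.Extended_Real"
    "HOL-Library.FuncSet"
    "HOL-Combinatorics.Orbits"
    "HOL-Combinatorics.Permutations"
    "Graph_Theory.Graph_Theory"
begin

section \<open>Metric graphs\<close>

text \<open>
  A finite simple undirected graph is a \<^locale>\<open>pair_graph\<close>: a finite, symmetric, loop-free set of
  arcs. The undirected edge \<open>{u, w}\<close> is the pair of opposite arcs \<open>(u, w)\<close>, \<open>(w, u)\<close>, so
  \<open>parcs G\<close> is the set of oriented edges, \<open>fst\<close> and \<open>snd\<close> are tail and head, and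
  \<open>prod.swap\<close> reverses the orientation. Lengths are attached to undirected edges.
\<close>

locale metric_graph = pair_graph G for G :: "'v pair_pre_digraph" +
  fixes l :: "'v set \<Rightarrow> real"
  assumes edge_length_pos: "(u, w) \<in> parcs G \<Longrightarrow> 0 < l {u, w}"

definition arc_length :: "('v set \<Rightarrow> real) \<Rightarrow> 'v \<times> 'v \<Rightarrow> real" where
  "arc_length l a = l {fst a, snd a}"

definition walk_length :: "('v set \<Rightarrow> real) \<Rightarrow> 'v list \<Rightarrow> real" where
  "walk_length l p = (\<Sum>a\<leftarrow>vwalk_arcs p. arc_length l a)"

definition walk_lengths :: "'v pair_pre_digraph \<Rightarrow> ('v set \<Rightarrow> real) \<Rightarrow> 'v \<Rightarrow> 'v \<Rightarrow> real set" where
  "walk_lengths G l u v =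
     {walk_length l p |p. vwalk p (with_proj G) \<and> hd p = u \<and> last p = v}"

definition birth_times :: "'v pair_pre_digraph \<Rightarrow> ('v set \<Rightarrow> real) \<Rightarrow> 'v \<Rightarrow> 'v \<Rightarrow> real set" where
  "birth_times G l vstar v = walk_lengths G l vstar v"

text \<open>
  The pair \<open>(a, s)\<close> stands for the point of the metric graph at distance \<open>s\<close> from the tail of
  \<open>a\<close> along the edge of \<open>a\<close>. A point has several such names: \<open>((u, w), s)\<close> and
  \<open>((w, u), l {u, w} - s)\<close> are the same point, and a vertex \<open>u\<close> is \<open>((u, w), 0)\<close> for every
  neighbour \<open>w\<close>. Instead of forming the quotient, \<open>graph_dist\<close> below is defined on names;
  in a connected graph it is \<open>0\<close> exactly between names of the same point. Every vertex has a name as soon as no vertex is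
  isolated, which \<open>cyclic_on\<close> in \<open>ordered_graph\<close> below guarantees.
\<close>

type_synonym 'v point = "('v \<times> 'v) \<times> real"

definition points :: "'v pair_pre_digraph \<Rightarrow> ('v set \<Rightarrow> real) \<Rightarrow> 'v point set" where
  "points G l = {(a, s). a \<in> parcs G \<and> 0 \<le> s \<and> s \<le> arc_length l a}"

text \<open>The two ways of leaving a point along its edge: the endpoint reached, and its distance.\<close>

definition exits :: "('v set \<Rightarrow> real) \<Rightarrow> 'v point \<Rightarrow> ('v \<times> real) set" where
  "exits l x = (case x of ((u, w), s) \<Rightarrow> {(u, s), (w, l {u, w} - s)})"

text \<open>
  Lengths of the paths between two points: the segment inside a common edge (whose two names may
  carry the same or opposite orientations), or an exit, a walk between vertices, and an entry.
\<close>

definition path_lengths ::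
    "'v pair_pre_digraph \<Rightarrow> ('v set \<Rightarrow> real) \<Rightarrow> 'v point \<Rightarrow> 'v point \<Rightarrow> real set" where
  "path_lengths G l x y =
     {\<bar>s - r\<bar> |a s r. x = (a, s) \<and> y = (a, r)} \<union>
     {\<bar>s - (arc_length l a - r)\<bar> |a s r. x = (a, s) \<and> y = (prod.swap a, r)} \<union>
     {p + d + q |u v p d q. (u, p) \<in> exits l x \<and> d \<in> walk_lengths G l u v \<and> (v, q) \<in> exits l y}"

definition graph_dist ::
    "'v pair_pre_digraph \<Rightarrow> ('v set \<Rightarrow> real) \<Rightarrow> 'v point \<Rightarrow> 'v point \<Rightarrow> real" where
  "graph_dist G l x y = Inf (path_lengths G l x y)"


section \<open>The dynamics\<close>

text \<open>
  \<open>(a, \<tau>) \<in> created G l vstar\<close>: a moving point is created at time \<open>\<tau>\<close> at the tail of \<open>a\<close> and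
  moves along \<open>a\<close>. It reaches the head of \<open>a\<close> at time \<open>\<tau> + arc_length l a\<close>.
\<close>

inductive_set created ::
    "'v pair_pre_digraph \<Rightarrow> ('v set \<Rightarrow> real) \<Rightarrow> 'v \<Rightarrow> (('v \<times> 'v) \<times> real) set"
  for G :: "'v pair_pre_digraph" and l :: "'v set \<Rightarrow> real" and vstar :: 'v where
  start: "a \<in> parcs G \<Longrightarrow> fst a = vstar \<Longrightarrow> (a, 0) \<in> created G l vstar"
| arrive: "(a, \<tau>) \<in> created G l vstar \<Longrightarrow> b \<in> parcs G \<Longrightarrow> fst b = snd a \<Longrightarrow>
    (b, \<tau> + arc_length l a) \<in> created G l vstar"

text \<open>
  A moving point is present from its creation until its arrival, the latter excluded: at that
  moment it is replaced by its successors, which sit at the same place.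
\<close>

definition moving_points ::
    "'v pair_pre_digraph \<Rightarrow> ('v set \<Rightarrow> real) \<Rightarrow> 'v \<Rightarrow> real \<Rightarrow> 'v point set" where
  "moving_points G l vstar t =
     {(a, t - \<tau>) |a \<tau>. (a, \<tau>) \<in> created G l vstar \<and> \<tau> \<le> t \<and> t < \<tau> + arc_length l a}"

definition saturated ::
    "'v pair_pre_digraph \<Rightarrow> ('v set \<Rightarrow> real) \<Rightarrow> 'v \<Rightarrow> real \<Rightarrow> real \<Rightarrow> bool" where
  "saturated G l vstar \<epsilon> t \<longleftrightarrow>
     (\<forall>x \<in> points G l. \<exists>y \<in> moving_points G l vstar t. graph_dist G l x y \<le> \<epsilon>)"

text \<open>Valued in \<^typ>\<open>ereal\<close>, so that the infimum of the empty set is \<open>\<infinity>\<close>.\<close>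

definition saturation_time ::
    "'v pair_pre_digraph \<Rightarrow> ('v set \<Rightarrow> real) \<Rightarrow> 'v \<Rightarrow> real \<Rightarrow> ereal" where
  "saturation_time G l vstar \<epsilon> =
     Inf (ereal ` {t0. 0 \<le> t0 \<and> (\<forall>t \<ge> t0. saturated G l vstar \<epsilon> t)})"


section \<open>Ordered graph data and the auxiliary interval exchange transformation\<close>

text \<open>
  \<open>cyclic_on\<close> asks for exactly one orbit. A vertex of degree one carries the identity; an isolated
  vertex has no cyclic permutation, so the one-vertex graph carries no ordered graph data.
\<close>

locale ordered_graph = metric_graph G l for G :: "'v pair_pre_digraph" and l +
  fixes \<sigma> :: "'v \<Rightarrow> 'v \<times> 'v \<Rightarrow> 'v \<times> 'v"
    and \<pi>\<^sub>0 :: "'v \<times> 'v \<Rightarrow> nat"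
  assumes sigma_permutes: "v \<in> pverts G \<Longrightarrow> \<sigma> v permutes out_arcs (with_proj G) v"
    and sigma_cyclic: "v \<in> pverts G \<Longrightarrow> cyclic_on (\<sigma> v) (out_arcs (with_proj G) v)"
    and pi0_bij: "bij_betw \<pi>\<^sub>0 (parcs G) {1..card (parcs G)}"

definition Phi :: "('v \<Rightarrow> 'v \<times> 'v \<Rightarrow> 'v \<times> 'v) \<Rightarrow> 'v \<times> 'v \<Rightarrow> 'v \<times> 'v" where
  "Phi \<sigma> a = \<sigma> (snd a) (prod.swap a)"

text \<open>\<open>Phi \<sigma>\<close> permutes \<open>parcs G\<close>, and \<open>\<pi>\<^sub>1\<close> is determined by \<open>\<pi>\<^sub>1 (Phi \<sigma> a) = \<pi>\<^sub>0 a\<close>.\<close>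

definition pi1 :: "'v pair_pre_digraph \<Rightarrow> ('v \<Rightarrow> 'v \<times> 'v \<Rightarrow> 'v \<times> 'v) \<Rightarrow> ('v \<times> 'v \<Rightarrow> nat) \<Rightarrow>
    'v \<times> 'v \<Rightarrow> nat" where
  "pi1 G \<sigma> \<pi>\<^sub>0 b = \<pi>\<^sub>0 (inv_into (parcs G) (Phi \<sigma>) b)"

definition left_end :: "'v pair_pre_digraph \<Rightarrow> ('v set \<Rightarrow> real) \<Rightarrow> ('v \<times> 'v \<Rightarrow> nat) \<Rightarrow>
    'v \<times> 'v \<Rightarrow> real" where
  "left_end G l \<pi> a = (\<Sum>b \<in> {b \<in> parcs G. \<pi> b < \<pi> a}. arc_length l b)"

definition right_end :: "'v pair_pre_digraph \<Rightarrow> ('v set \<Rightarrow> real) \<Rightarrow> ('v \<times> 'v \<Rightarrow> nat) \<Rightarrow>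
    'v \<times> 'v \<Rightarrow> real" where
  "right_end G l \<pi> a = (\<Sum>b \<in> {b \<in> parcs G. \<pi> b \<le> \<pi> a}. arc_length l b)"

text \<open>For \<open>\<pi> = \<pi>\<^sub>0\<close> this is \<open>I\<^sub>a\<close>, for \<open>\<pi> = pi1 G \<sigma> \<pi>\<^sub>0\<close> it is \<open>J\<^sub>a\<close>.\<close>

definition exchange_interval :: "'v pair_pre_digraph \<Rightarrow> ('v set \<Rightarrow> real) \<Rightarrow> ('v \<times> 'v \<Rightarrow> nat) \<Rightarrow>
    'v \<times> 'v \<Rightarrow> real set" where
  "exchange_interval G l \<pi> a = {left_end G l \<pi> a ..< right_end G l \<pi> a}"

definition T_aux :: "'v pair_pre_digraph \<Rightarrow> ('v set \<Rightarrow> real) \<Rightarrow>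
    ('v \<Rightarrow> 'v \<times> 'v \<Rightarrow> 'v \<times> 'v) \<Rightarrow> ('v \<times> 'v \<Rightarrow> nat) \<Rightarrow> real \<Rightarrow> real" where
  "T_aux G l \<sigma> \<pi>\<^sub>0 = (\<lambda>x \<in> {0 ..< (\<Sum>a \<in> parcs G. arc_length l a)}.
     let a = (THE a. a \<in> parcs G \<and> x \<in> exchange_interval G l \<pi>\<^sub>0 a)
     in x - left_end G l \<pi>\<^sub>0 a + left_end G l (pi1 G \<sigma> \<pi>\<^sub>0) a)"

text \<open>
  The estimate is a property attributed to the interval exchange transformation \<open>T\<close>, but the
  condition it consists of mentions only the graph and its birth times; \<open>T\<close> does not occur in it.
\<close>

definition birth_time_transfer_estimate :: "(real \<Rightarrow> real) \<Rightarrow> 'v pair_pre_digraph \<Rightarrow>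
    ('v set \<Rightarrow> real) \<Rightarrow> 'v \<Rightarrow> (real \<Rightarrow> real) \<Rightarrow> bool" where
  "birth_time_transfer_estimate T G l vstar H\<^sub>T \<longleftrightarrow>
     (\<forall>\<^sub>F \<epsilon> in at_right 0. \<forall>a \<in> parcs G. \<forall>t \<ge> H\<^sub>T \<epsilon> + arc_length l a.
        \<forall>s \<in> {0 .. arc_length l a - \<epsilon>}.
          \<exists>\<tau> \<in> birth_times G l vstar (fst a). 0 \<le> t - s - \<tau> \<and> t - s - \<tau> \<le> \<epsilon>)"

end

theory Submission
  imports Defs
begin

text \<open>
  A birth at the tail of \<open>a\<close> between \<open>t - s - \<epsilon>\<close> and \<open>t - s\<close> puts a moving point on \<open>a\<close>, at time
  \<open>t\<close>, within \<open>\<epsilon>\<close> ahead of the point at distance \<open>s\<close> from the tail. The transfer estimate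
  provides such births for \<open>s \<le> l(a) - \<epsilon>\<close>; a point closer than \<open>\<epsilon>\<close> to the head is seen from the
  reversed edge instead. Hence \<open>\<tau>\<^sub>s(\<epsilon>) \<le> H\<^sub>T(\<epsilon>) + max l\<close>, and a bounded term does not affect
  the power of \<open>\<epsilon>\<close>.
\<close>

text \<open>Crossing the first edge only shifts the clock by its length, so the start time
  \<open>\<tau>\<close> stays free in the induction. The hypothesis covers every arc leaving
  \<open>hd p\<close> because an arrival emits points on all outgoing arcs at once, and this passes
  to the next vertex.\<close>

lemma created_along_walk:
  assumes "vwalk p (with_proj G)"
    and "\<And>a. a \<in> parcs G \<Longrightarrow> fst a = hd p \<Longrightarrow> (a, \<tau>) \<in> created G l vstar"
    and "b \<in> parcs G" "fst b = last p"
  shows "(b, \<tau> + walk_length l p) \<in> created G l vstar"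
  using assms
proof (induction p arbitrary: \<tau> rule: vwalk_induct)
  case (Base u)
  then show ?case by (simp add: walk_length_def)
next
  case (Cons u v es)
  let ?d = "arc_length l (u, v)"
  have "((u, v), \<tau>) \<in> created G l vstar"
    using Cons.hyps Cons.prems(1) by simp
  then have "(a, \<tau> + ?d) \<in> created G l vstar" if "a \<in> parcs G" "fst a = v" for a
    using that by (auto intro: created.arrive)
  then have "(b, (\<tau> + ?d) + walk_length l (v # es)) \<in> created G l vstar"
    using Cons.IH[of "\<tau> + ?d"] Cons.prems by simp
  then show ?case by (simp add: walk_length_def add.assoc)
qed

lemma created_birth_time:
  assumes "\<tau> \<in> birth_times G l vstar (fst a)" "a \<in> parcs G"
  shows "(a, \<tau>) \<in> created G l vstar"
proof -
  obtain p where "vwalk p (with_proj G)" "hd p = vstar" "last p = fst a" "\<tau> = walk_length l p"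
    using assms(1) by (auto simp: birth_times_def walk_lengths_def)
  then show ?thesis
    using created_along_walk[of p G 0 l vstar a] assms(2) by (auto intro: created.start)
qed

lemma arc_length_swap: "arc_length l (prod.swap a) = arc_length l a"
  by (simp add: arc_length_def insert_commute)

context metric_graph
begin

lemma swap_in_arcs: "a \<in> parcs G \<Longrightarrow> prod.swap a \<in> parcs G"
  by (cases a) (auto intro: arcs_symmetric)

lemma arc_length_pos: "a \<in> parcs G \<Longrightarrow> 0 < arc_length l a"
  using edge_length_pos[of "fst a" "snd a"] by (simp add: arc_length_def)

lemma walk_lengths_nonneg:
  assumes "d \<in> walk_lengths G l u v"
  shows "0 \<le> d"
proof -
  obtain p where p: "vwalk p (with_proj G)" "d = walk_length l p"
    using assms by (auto simp: walk_lengths_def)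
  have "0 \<le> arc_length l a" if "a \<in> set (vwalk_arcs p)" for a
    using p(1) that arc_length_pos[of a] by (auto simp: vwalk_def)
  then show ?thesis
    by (auto simp: p(2) walk_length_def intro!: sum_list_nonneg)
qed

lemma exits_nonneg: "x \<in> points G l \<Longrightarrow> (v, q) \<in> exits l x \<Longrightarrow> 0 \<le> q"
  by (auto simp: points_def exits_def arc_length_def)

text \<open>A real \<open>Inf\<close> is a lower bound only for a set bounded below; here 0 is a
  bound. Membership in \<open>points\<close> keeps the exit distances nonnegative.\<close>

lemma graph_dist_le:
  assumes "x \<in> points G l" "y \<in> points G l" "d \<in> path_lengths G l x y"
  shows "graph_dist G l x y \<le> d"
proof -
  have "0 \<le> d'" if "d' \<in> path_lengths G l x y" for d'
    using that exits_nonneg[OF assms(1)] exits_nonneg[OF assms(2)] walk_lengths_nonneg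
    unfolding path_lengths_def by (fastforce intro: add_nonneg_nonneg)
  then have "bdd_below (path_lengths G l x y)" by (rule bdd_belowI)
  then show ?thesis
    using assms(3) by (simp add: graph_dist_def cInf_lower)
qed

lemma moving_points_subset_points: "moving_points G l vstar t \<subseteq> points G l"
proof -
  have "a \<in> parcs G" if "(a, \<tau>) \<in> created G l vstar" for a \<tau>
    using that by cases auto
  then show ?thesis by (auto simp: moving_points_def points_def)
qed

text \<open>
  The second alternative is needed for \<open>r = arc_length l a\<close> only: a point arriving at the head at
  time \<open>t\<close> has already been replaced by its successors.
\<close>

lemma moving_point_ahead:
  assumes a: "a \<in> parcs G"
    and \<tau>: "\<tau> \<in> birth_times G l vstar (fst a)" "0 \<le> t - s - \<tau>" "t - s - \<tau> \<le> \<epsilon>"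
    and s: "0 \<le> s" "s \<le> arc_length l a - \<epsilon>"
  obtains r where "s \<le> r" "r \<le> s + \<epsilon>" "(a, r) \<in> moving_points G l vstar t \<or>
    (prod.swap a, arc_length l a - r) \<in> moving_points G l vstar t"
proof
  let ?r = "t - \<tau>"
  show "s \<le> ?r" "?r \<le> s + \<epsilon>" using \<tau> by auto
  have created: "(a, \<tau>) \<in> created G l vstar" using \<tau>(1) a by (rule created_birth_time)
  show "(a, ?r) \<in> moving_points G l vstar t \<or>
    (prod.swap a, arc_length l a - ?r) \<in> moving_points G l vstar t"
  proof (cases "?r < arc_length l a")
    case True
    then have "(a, ?r) \<in> moving_points G l vstar t"
      using created \<tau>(2) s(1) by (cases a) (auto simp: moving_points_def)
    then show ?thesis ..
  next
    case False
    \<comment> \<open>The hypotheses give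
      \<open>t - \<tau> \<le> s + \<epsilon> \<le> arc_length l a\<close>, so the arrival happens
      exactly at time \<open>t\<close>.\<close>
    then have t: "t = \<tau> + arc_length l a" using \<tau> s by simp
    have "(prod.swap a, t) \<in> created G l vstar"
      unfolding t using created swap_in_arcs[OF a] by (rule created.arrive) simp
    then have "(prod.swap a, t - t) \<in> moving_points G l vstar t"
      using arc_length_pos[OF swap_in_arcs[OF a]] by (cases a) (auto simp: moving_points_def)
    then show ?thesis by (simp add: t)
  qed
qed

lemma saturatedI:
  assumes births: "\<And>a s. a \<in> parcs G \<Longrightarrow> 0 \<le> s \<Longrightarrow> s \<le> arc_length l a - \<epsilon> \<Longrightarrow>
      \<exists>\<tau> \<in> birth_times G l vstar (fst a). 0 \<le> t - s - \<tau> \<and> t - s - \<tau> \<le> \<epsilon>"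
    and small: "\<And>a. a \<in> parcs G \<Longrightarrow> 2 * \<epsilon> \<le> arc_length l a"
  shows "saturated G l vstar \<epsilon> t"
  unfolding saturated_def
proof
  fix x assume x: "x \<in> points G l"
  then obtain a s where xas: "x = (a, s)" and a: "a \<in> parcs G" and s: "0 \<le> s" "s \<le> arc_length l a"
    by (auto simp: points_def)
  let ?L = "arc_length l a"
  \<comment> \<open>The two alternatives are the two names of one point of the edge, at distance
    \<open>\<bar>s - r\<bar>\<close> from \<open>x\<close> along it.\<close>
  have near: "\<exists>y\<in>moving_points G l vstar t. graph_dist G l x y \<le> \<epsilon>"
    if "\<bar>s - r\<bar> \<le> \<epsilon>" "(a, r) \<in> moving_points G l vstar t \<or>
    (prod.swap a, ?L - r) \<in> moving_points G l vstar t" for r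
    using that(2)
  proof
    assume y: "(a, r) \<in> moving_points G l vstar t"
    have "graph_dist G l x (a, r) \<le> \<bar>s - r\<bar>"
      using moving_points_subset_points y x
      by (intro graph_dist_le) (auto simp: path_lengths_def xas)
    then show ?thesis using y that(1) by force
  next
    assume y: "(prod.swap a, ?L - r) \<in> moving_points G l vstar t"
    \<comment> \<open>The double difference is left unsimplified to match the clause of
      \<open>path_lengths\<close> for opposite orientations.\<close>
    have "\<bar>s - (?L - (?L - r))\<bar> \<in> path_lengths G l x (prod.swap a, ?L - r)"
      unfolding path_lengths_def xas by blast
    then have "graph_dist G l x (prod.swap a, ?L - r) \<le> \<bar>s - (?L - (?L - r))\<bar>"
      using moving_points_subset_points y x by (intro graph_dist_le) auto
    then show ?thesis using y that(1) by force
  qed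
  show "\<exists>y\<in>moving_points G l vstar t. graph_dist G l x y \<le> \<epsilon>"
  proof (cases "s \<le> ?L - \<epsilon>")
    case True
    then obtain \<tau> where "\<tau> \<in> birth_times G l vstar (fst a)" "0 \<le> t - s - \<tau>" "t - s - \<tau> \<le> \<epsilon>"
      using births a s by blast
    with a s(1) True obtain r where "s \<le> r" "r \<le> s + \<epsilon>" "(a, r) \<in> moving_points G l vstar t \<or>
      (prod.swap a, ?L - r) \<in> moving_points G l vstar t"
      by (elim moving_point_ahead) auto
    then show ?thesis by (intro near[of r]) auto
  next
    case False
    let ?a = "prod.swap a" and ?s = "?L - s"
    \<comment> \<open>Seen from the head, the point is at distance less than \<epsilon>, and
      \<epsilon> is at most \<open>?L - \<epsilon>\<close> by \<open>small\<close>.\<close>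
    have a': "?a \<in> parcs G" and s': "0 \<le> ?s" "?s \<le> arc_length l ?a - \<epsilon>"
      using swap_in_arcs a s small[OF a] False by (auto simp: arc_length_swap)
    then obtain \<tau> where "\<tau> \<in> birth_times G l vstar (fst ?a)" "0 \<le> t - ?s - \<tau>" "t - ?s - \<tau> \<le> \<epsilon>"
      using births by blast
    with a' s' obtain r where r: "?s \<le> r" "r \<le> ?s + \<epsilon>" "(?a, r) \<in> moving_points G l vstar t \<or>
      (prod.swap ?a, arc_length l ?a - r) \<in> moving_points G l vstar t"
      by (elim moving_point_ahead) auto
    \<comment> \<open>Position \<open>r\<close> on the reversed arc is position
      \<open>?L - r\<close> on \<open>a\<close>; reversing swaps the two alternatives of
      \<open>near\<close>.\<close>
    then show ?thesis
      by (intro near[of "?L - r"]) (auto simp: arc_length_swap)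
  qed
qed

text \<open>The sum of all arc lengths serves as a bound for each single length. The maximum with 0
  reflects that saturation times range over nonnegative reals while \<open>H\<close> may be
  negative; a free \<open>h\<close> lets any upper bound for \<open>H\<close> be inserted.\<close>

lemma saturation_time_le_transfer:
  assumes "birth_time_transfer_estimate T G l vstar H"
  shows "\<forall>\<^sub>F \<epsilon> in at_right 0. \<forall>h \<ge> max 0 (H \<epsilon>).
    saturation_time G l vstar \<epsilon> \<le> ereal (h + (\<Sum>a\<in>parcs G. arc_length l a))"
proof -
  let ?S = "\<Sum>a\<in>parcs G. arc_length l a"
  have "\<forall>\<^sub>F \<epsilon> in at_right 0. 2 * \<epsilon> \<le> arc_length l a" if "a \<in> parcs G" for a
    using arc_length_pos[OF that]
    by (intro eventually_at_rightI[of 0 "arc_length l a / 2"]) auto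
  \<comment> \<open>Finitely many arcs allow one threshold for \<epsilon> on all of them.\<close>
  then have "\<forall>\<^sub>F \<epsilon> in at_right 0. \<forall>a\<in>parcs G. 2 * \<epsilon> \<le> arc_length l a"
    using pair_finite_arcs by (simp add: eventually_ball_finite)
  with assms[unfolded birth_time_transfer_estimate_def] show ?thesis
  proof eventually_elim
    case (elim \<epsilon>)
    have le_S: "arc_length l a \<le> ?S" if "a \<in> parcs G" for a
      using that pair_finite_arcs arc_length_pos by (intro member_le_sum) (auto intro: less_imp_le)
    have "0 \<le> ?S" using arc_length_pos by (intro sum_nonneg) (auto intro: less_imp_le)
    moreover have "saturated G l vstar \<epsilon> t" if "max 0 (H \<epsilon>) \<le> h" "h + ?S \<le> t" for h t
    proof (rule saturatedI)
      fix a s assume a: "a \<in> parcs G" and s: "0 \<le> s" "s \<le> arc_length l a - \<epsilon>"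
      have "t \<ge> H \<epsilon> + arc_length l a" using le_S[OF a] that by simp
      with elim(1) a s
      show "\<exists>\<tau>\<in>birth_times G l vstar (fst a). 0 \<le> t - s - \<tau> \<and> t - s - \<tau> \<le> \<epsilon>" by simp
    qed (use elim(2) in auto)
    ultimately show ?case
      unfolding saturation_time_def by (auto intro!: Inf_lower)
  qed
qed

end

theorem corollary3p20:
  fixes G :: "'v pair_pre_digraph"
    and l :: "'v set \<Rightarrow> real"
    and \<sigma> :: "'v \<Rightarrow> 'v \<times> 'v \<Rightarrow> 'v \<times> 'v"
    and \<pi>\<^sub>0 :: "'v \<times> 'v \<Rightarrow> nat"
    and vstar :: 'v
    and H\<^sub>T :: "real \<Rightarrow> real"
    and \<kappa> C :: real
  assumes "ordered_graph G l \<sigma> \<pi>\<^sub>0"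
    and "Digraph_Component.connected (with_proj G)"
    and "vstar \<in> pverts G"
    and "birth_time_transfer_estimate (T_aux G l \<sigma> \<pi>\<^sub>0) G l vstar H\<^sub>T"
    and "\<kappa> > 0" and "C > 0"
    and "\<forall>\<^sub>F \<epsilon> in at_right 0. H\<^sub>T \<epsilon> \<le> C * \<epsilon> powr (- \<kappa>)"
    and "\<forall>\<eta> \<in> {0<..<1}. \<exists>C\<^sub>\<eta>. \<forall>\<^sub>F \<epsilon> in at_right 0.
           H\<^sub>T \<epsilon> \<le> C\<^sub>\<eta> * \<epsilon> powr (- ((1 + \<eta>) / (1 - \<eta>)))"
  shows "\<forall>\<eta> \<in> {0<..<1}. \<exists>K\<^sub>\<eta>. \<forall>\<^sub>F \<epsilon> in at_right 0.
           saturation_time G l vstar \<epsilon> \<le> ereal (K\<^sub>\<eta> * \<epsilon> powr (- ((1 + \<eta>) / (1 - \<eta>))))"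
proof (intro ballI)
  interpret ordered_graph G l \<sigma> \<pi>\<^sub>0 by fact
  fix \<eta> :: real assume \<eta>: "\<eta> \<in> {0<..<1}"
  define p where "p = (1 + \<eta>) / (1 - \<eta>)"
  have "0 \<le> p" using \<eta> by (simp add: p_def)
  let ?S = "\<Sum>a\<in>parcs G. arc_length l a"
  have S: "0 \<le> ?S" using arc_length_pos by (intro sum_nonneg) (auto intro: less_imp_le)
  obtain c where c: "\<forall>\<^sub>F \<epsilon> in at_right 0. H\<^sub>T \<epsilon> \<le> c * \<epsilon> powr (- p)"
    using assms(8) \<eta> unfolding p_def by blast
  have "\<forall>\<^sub>F \<epsilon> in at_right (0::real). \<epsilon> \<in> {0<..<1}"
    by (rule eventually_at_rightI[of 0 1]) auto
  \<comment> \<open>The witness for the final constant is \<open>\<bar>c\<bar> + ?S\<close>; the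
    absolute value makes the bound on the transfer function nonnegative, as \<open>h\<close> must
    be.\<close>
  with c saturation_time_le_transfer[OF assms(4)]
  have "\<forall>\<^sub>F \<epsilon> in at_right 0. saturation_time G l vstar \<epsilon> \<le> ereal ((\<bar>c\<bar> + ?S) * \<epsilon> powr (- p))"
  proof eventually_elim
    case (elim \<epsilon>)
    have "c * \<epsilon> powr (- p) \<le> \<bar>c\<bar> * \<epsilon> powr (- p)" by (intro mult_right_mono) auto
    with elim(1) have "max 0 (H\<^sub>T \<epsilon>) \<le> \<bar>c\<bar> * \<epsilon> powr (- p)" by simp
    then have "saturation_time G l vstar \<epsilon> \<le> ereal (\<bar>c\<bar> * \<epsilon> powr (- p) + ?S)"
      using elim(2) by blast
    \<comment> \<open>Since \<epsilon> < 1 and the exponent is nonpositive, the power is at least 1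
      and absorbs the additive term \<open>?S\<close>.\<close>
    also have "1 \<le> \<epsilon> powr (- p)"
      using elim(3) \<open>0 \<le> p\<close> powr_mono'[of "- p" 0 \<epsilon>] by simp
    then have "\<bar>c\<bar> * \<epsilon> powr (- p) + ?S \<le> (\<bar>c\<bar> + ?S) * \<epsilon> powr (- p)"
      using mult_left_mono[OF _ S, of 1] by (simp add: distrib_right)
    finally show ?case by simp
  qed
  then show "\<exists>K\<^sub>\<eta>. \<forall>\<^sub>F \<epsilon> in at_right 0.
      saturation_time G l vstar \<epsilon> \<le> ereal (K\<^sub>\<eta> * \<epsilon> powr (- ((1 + \<eta>) / (1 - \<eta>))))"
    unfolding p_def by blast
qed

end
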